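(* Let $S$ be a reversible semitopological semigroup, let $(X,Q)$ be a locally convex space, and let $K$ be a nonempty compact convex subset of $X$. Then every super asymptotically separately $Q$-nonexpansive and separately continuous action of $S$ on $K$ has a common fixed point, i.e. there is $x_0\in K$ with $s.x_0=x_0$ for all $s\in S$.
   Context: A semitopological semigroup is a semigroup $S$ with a Hausdorff topology such that for each fixed $t\in S$ the maps $s\mapsto ts$ and $s\mapsto st$ are continuous. A left (resp. right) ideal is a nonempty subset $I\subseteq S$ with $SI\subseteq I$ (resp. $IS\subseteq I$). $S$ is right (resp. left) reversible if any two closed left (resp. right) ideals of $S$ intersect; $S$ is reversible if it is both left and right reversible. $(X,Q)$ denotes a (Hausdorff) locally convex space $X$ together with a selected family $Q$ of seminorms defining its topology; neither metrizability nor completeness is assumed. An action of $S$ on $K$ is a map $S\times K\to K$, $(s,x)\mapsto s.x$, with $(st).x=s.(t.x)$; it is separately continuous if this map is separately continuous. It is super asymptotically separately $Q$-nonexpansive if for all $x\in K$, $t\in S$, $q\in Q$ there is a left ideal $I_x^{q,t}$ of $S$ such that $q(st.x-st.y)\le q(x-y)$ for all $s\in I_x^{q,t}$ and all $y\in K$. *)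

theory Defs
  imports "HOL-Analysis.Analysis"
begin

class semitopological_semigroup = semigroup_mult + t2_space +
  assumes filterlim_mult_left_nhds: "filterlim (\<lambda>s. t * s) (nhds (t * a)) (nhds a)"
    and filterlim_mult_right_nhds: "filterlim (\<lambda>s. s * t) (nhds (a * t)) (nhds a)"

text \<open>
  The class axioms say that all translations are continuous; they are phrased with filters because
  \<open>continuous_on\<close> is not available inside the class specification.
\<close>

lemma filterlim_nhds_iff_continuous_on:
  "(\<forall>a. filterlim f (nhds (f a)) (nhds a)) \<longleftrightarrow> continuous_on UNIV f"
  for f :: "'a::topological_space \<Rightarrow> 'b::topological_space"
  by (simp add: continuous_on_def tendsto_at_iff_tendsto_nhds)

lemma continuous_on_translations:
  fixes t :: "'s::semitopological_semigroup"
  shows "continuous_on UNIV (\<lambda>s. t * s)" and "continuous_on UNIV (\<lambda>s. s * t)"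
  by (simp_all add: filterlim_mult_left_nhds filterlim_mult_right_nhds
      flip: filterlim_nhds_iff_continuous_on)

definition left_ideal :: "'s::semigroup_mult set \<Rightarrow> bool" where
  "left_ideal I \<longleftrightarrow> I \<noteq> {} \<and> (\<forall>s. \<forall>i\<in>I. s * i \<in> I)"

definition right_ideal :: "'s::semigroup_mult set \<Rightarrow> bool" where
  "right_ideal I \<longleftrightarrow> I \<noteq> {} \<and> (\<forall>i\<in>I. \<forall>s. i * s \<in> I)"

text \<open>Note the switch of sides: left reversibility concerns right ideals and vice versa.\<close>

definition right_reversible :: "'s::semitopological_semigroup itself \<Rightarrow> bool" where
  "right_reversible _ \<longleftrightarrow>
     (\<forall>I J :: 's set. closed I \<and> left_ideal I \<and> closed J \<and> left_ideal J \<longrightarrow> I \<inter> J \<noteq> {})"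

definition left_reversible :: "'s::semitopological_semigroup itself \<Rightarrow> bool" where
  "left_reversible _ \<longleftrightarrow>
     (\<forall>I J :: 's set. closed I \<and> right_ideal I \<and> closed J \<and> right_ideal J \<longrightarrow> I \<inter> J \<noteq> {})"

definition reversible :: "'s::semitopological_semigroup itself \<Rightarrow> bool" where
  "reversible S \<longleftrightarrow> left_reversible S \<and> right_reversible S"

definition seminorm :: "('x::real_vector \<Rightarrow> real) \<Rightarrow> bool" where
  "seminorm q \<longleftrightarrow>
     (\<forall>x. 0 \<le> q x) \<and> (\<forall>c x. q (c *\<^sub>R x) = \<bar>c\<bar> * q x) \<and> (\<forall>x y. q (x + y) \<le> q x + q y)"

text \<open>
  The topology of the type \<open>'x\<close> is the one defined by the family \<open>Q\<close> of seminorms: finite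
  intersections of open \<open>Q\<close>-balls around a point form a neighbourhood base there. The family is not
  required to be directed. The Hausdorff property comes from the class \<open>t2_space\<close>. A complex
  locally convex space is covered by restriction of scalars, since complex seminorms are in
  particular real ones.
\<close>

definition locally_convex_space :: "('x::{real_vector, t2_space} \<Rightarrow> real) set \<Rightarrow> bool" where
  "locally_convex_space Q \<longleftrightarrow>
     (\<forall>q\<in>Q. seminorm q) \<and>
     (\<forall>U :: 'x set. open U \<longleftrightarrow>
        (\<forall>x\<in>U. \<exists>F e. finite F \<and> F \<subseteq> Q \<and> 0 < e \<and> {y. \<forall>q\<in>F. q (y - x) < e} \<subseteq> U))"

text \<open>Only the values of \<open>act s\<close> on \<open>K\<close> matter in the following definitions.\<close>

definition action_on :: "('s::semigroup_mult \<Rightarrow> 'x \<Rightarrow> 'x) \<Rightarrow> 'x set \<Rightarrow> bool" where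
  "action_on act K \<longleftrightarrow>
     (\<forall>s. \<forall>x\<in>K. act s x \<in> K) \<and> (\<forall>s t. \<forall>x\<in>K. act (s * t) x = act s (act t x))"

definition separately_continuous_on ::
    "('s::topological_space \<Rightarrow> 'x::topological_space \<Rightarrow> 'x) \<Rightarrow> 'x set \<Rightarrow> bool" where
  "separately_continuous_on act K \<longleftrightarrow>
     (\<forall>s. continuous_on K (act s)) \<and> (\<forall>x\<in>K. continuous_on UNIV (\<lambda>s. act s x))"

definition super_asymptotically_separately_nonexpansive ::
    "('x::real_vector \<Rightarrow> real) set \<Rightarrow> ('s::semigroup_mult \<Rightarrow> 'x \<Rightarrow> 'x) \<Rightarrow> 'x set \<Rightarrow> bool" where
  "super_asymptotically_separately_nonexpansive Q act K \<longleftrightarrow>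
     (\<forall>x\<in>K. \<forall>t. \<forall>q\<in>Q. \<exists>I. left_ideal I \<and>
        (\<forall>s\<in>I. \<forall>y\<in>K. q (act (s * t) x - act (s * t) y) \<le> q (x - y)))"

end

theory Submission
  imports Defs
begin

text \<open>
  Let \<open>M\<close> be the set of pointwise limits of the maps \<open>act s\<close> as \<open>s\<close> runs through the closed left
  ideals. Right reversibility and compactness make \<open>M\<close> nonempty, and the asymptotic condition makes
  every element of \<open>M\<close> nonexpansive for all seminorms at once. \<open>M\<close> is closed under composition, and
  left reversibility of the topological semigroup passes to \<open>M\<close> as an abstract semigroup: any two
  elements have a common right multiple. By the classical argument (a minimal invariant compact set
  is mapped onto itself, and normal structure shrinks it to a point) \<open>M\<close> has a common fixed point
  \<open>x\<close>. Since \<open>act s \<circ> m \<in> M\<close> for \<open>m \<in> M\<close>, it follows that \<open>act s x = act s (m x) = x\<close>.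
\<close>

section \<open>Seminorms and the topology they define\<close>

lemma seminorm_nonneg: "seminorm q \<Longrightarrow> 0 \<le> q x"
  and seminorm_scale: "seminorm q \<Longrightarrow> q (c *\<^sub>R x) = \<bar>c\<bar> * q x"
  and seminorm_triangle: "seminorm q \<Longrightarrow> q (x + y) \<le> q x + q y"
  by (auto simp: seminorm_def)

lemma seminorm_zero: "seminorm q \<Longrightarrow> q 0 = 0"
  using seminorm_scale[of q 0 0] by simp

lemma seminorm_diff_commute: "seminorm q \<Longrightarrow> q (x - y) = q (y - x)"
  using seminorm_scale[of q "-1" "x - y"] by simp

lemma seminorm_diff_triangle: "seminorm q \<Longrightarrow> q (x - z) \<le> q (x - y) + q (y - z)"
  using seminorm_triangle[of q "x - y" "y - z"] by simp

lemma seminorm_sum_le: "seminorm q \<Longrightarrow> q (\<Sum>i\<in>A. f i) \<le> (\<Sum>i\<in>A. q (f i))"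
proof (induction A rule: infinite_finite_induct)
  case (insert a A)
  then show ?case
    using seminorm_triangle[of q "f a" "sum f A"] by simp
qed (auto simp: seminorm_zero)

lemma locally_convex_space_seminorm: "locally_convex_space Q \<Longrightarrow> q \<in> Q \<Longrightarrow> seminorm q"
  by (simp add: locally_convex_space_def)

lemma locally_convex_space_open_iff:
  assumes "locally_convex_space Q"
  shows "open U \<longleftrightarrow>
    (\<forall>x\<in>U. \<exists>F e. finite F \<and> F \<subseteq> Q \<and> 0 < e \<and> {y. \<forall>q\<in>F. q (y - x) < e} \<subseteq> U)"
  using assms unfolding locally_convex_space_def by (elim conjE allE)

lemma open_seminorm_ball:
  assumes "locally_convex_space Q" "q \<in> Q"
  shows "open {y. q (y - a) < e}"
proof -
  have sq: "seminorm q"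
    using assms by (rule locally_convex_space_seminorm)
  have "\<exists>F d. finite F \<and> F \<subseteq> Q \<and> 0 < d \<and> {y. \<forall>q\<in>F. q (y - x) < d} \<subseteq> {y. q (y - a) < e}"
    if "q (x - a) < e" for x
  proof -
    have "{y. \<forall>q'\<in>{q}. q' (y - x) < e - q (x - a)} \<subseteq> {y. q (y - a) < e}"
      using seminorm_diff_triangle[OF sq, of _ a x] by (auto simp: less_diff_eq intro: le_less_trans)
    then show ?thesis
      using that assms(2) by (intro exI[of _ "{q}"] exI[of _ "e - q (x - a)"]) auto
  qed
  then show ?thesis
    by (intro locally_convex_space_open_iff[OF assms(1), THEN iffD2] ballI) simp
qed

lemma tendsto_locally_convex_iff:
  assumes "locally_convex_space Q"
  shows "(f \<longlongrightarrow> l) F \<longleftrightarrow> (\<forall>q\<in>Q. ((\<lambda>x. q (f x - l)) \<longlongrightarrow> 0) F)"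
proof (intro iffI ballI)
  fix q assume f: "(f \<longlongrightarrow> l) F" and q: "q \<in> Q"
  have sq: "seminorm q"
    using assms q by (rule locally_convex_space_seminorm)
  show "((\<lambda>x. q (f x - l)) \<longlongrightarrow> 0) F"
  proof (rule order_tendstoI)
    fix e :: real assume "0 < e"
    then show "\<forall>\<^sub>F x in F. q (f x - l) < e"
      using topological_tendstoD[OF f open_seminorm_ball[OF assms q, of l e]] seminorm_zero[OF sq]
      by simp
  next
    fix e :: real assume "e < 0"
    then show "\<forall>\<^sub>F x in F. e < q (f x - l)"
      using seminorm_nonneg[OF sq] by (intro always_eventually allI) (rule less_le_trans)
  qed
next
  assume lim: "\<forall>q\<in>Q. ((\<lambda>x. q (f x - l)) \<longlongrightarrow> 0) F"
  show "(f \<longlongrightarrow> l) F"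
  proof (rule topological_tendstoI)
    fix U assume "open U" "l \<in> U"
    then obtain A e where A: "finite A" "A \<subseteq> Q" "0 < e" "{y. \<forall>q\<in>A. q (y - l) < e} \<subseteq> U"
      using locally_convex_space_open_iff[OF assms, of U] by blast
    have "\<forall>\<^sub>F x in F. \<forall>q\<in>A. q (f x - l) < e"
      using A lim by (intro eventually_ball_finite ballI) (auto intro: order_tendstoD)
    then show "\<forall>\<^sub>F x in F. f x \<in> U"
      by (rule eventually_mono) (use A in auto)
  qed
qed

text \<open>The Hausdorff property makes \<open>Q\<close> separate points: if all seminorms of
  \<open>x - y\<close> vanish, the constant sequence \<open>x\<close> also converges to
  \<open>y\<close>, and limits are unique.\<close>

lemma locally_convex_space_eqI:
  fixes x y :: "'x::{real_vector, t2_space}"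
  assumes "locally_convex_space Q" "\<And>q. q \<in> Q \<Longrightarrow> q (x - y) = 0"
  shows "x = y"
proof -
  have "((\<lambda>_. x) \<longlongrightarrow> y) sequentially"
    unfolding tendsto_locally_convex_iff[OF assms(1)]
  proof
    fix q assume "q \<in> Q"
    then have "q (x - y) = 0" by (rule assms(2))
    then show "(\<lambda>_. q (x - y)) \<longlonglongrightarrow> 0" by simp
  qed
  then show ?thesis
    using tendsto_const_iff sequentially_bot by blast
qed

lemma tendsto_seminorm_diff:
  assumes "locally_convex_space Q" "q \<in> Q" "(f \<longlongrightarrow> l) F" "(g \<longlongrightarrow> k) F"
  shows "((\<lambda>x. q (f x - g x)) \<longlongrightarrow> q (l - k)) F"
proof -
  have sq: "seminorm q"
    using assms(1,2) by (rule locally_convex_space_seminorm)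
  have "((\<lambda>x. q (f x - l) + q (g x - k)) \<longlongrightarrow> 0 + 0) F"
    using assms by (intro tendsto_add) (simp_all add: tendsto_locally_convex_iff)
  then have lim: "((\<lambda>x. q (f x - l) + q (g x - k)) \<longlongrightarrow> 0) F"
    by simp
  have "norm (q (f x - g x) - q (l - k)) \<le> q (f x - l) + q (g x - k)" for x
    using seminorm_diff_triangle[OF sq, of "f x" "g x" l]
      seminorm_diff_triangle[OF sq, of l "g x" k]
      seminorm_diff_triangle[OF sq, of l k "f x"]
      seminorm_diff_triangle[OF sq, of "f x" k "g x"]
      seminorm_diff_commute[OF sq, of "f x" l] seminorm_diff_commute[OF sq, of "g x" k]
    by (simp add: abs_if)
  then have "((\<lambda>x. q (f x - g x) - q (l - k)) \<longlongrightarrow> 0) F"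
    by (intro Lim_null_comparison[OF _ lim] always_eventually allI)
  then show ?thesis
    by (rule LIM_zero_cancel)
qed

lemma continuous_on_seminorm_diff:
  assumes "locally_convex_space Q" "q \<in> Q"
  shows "continuous_on A (\<lambda>x. q (x - a))"
  unfolding continuous_on_def by (intro ballI tendsto_seminorm_diff[OF assms] tendsto_ident_at tendsto_const)

lemma closed_seminorm_cball:
  assumes "locally_convex_space Q" "q \<in> Q"
  shows "closed {x. q (x - a) \<le> r}"
  by (rule closed_Collect_le[OF continuous_on_seminorm_diff[OF assms] continuous_on_const])

lemma convex_seminorm_cball:
  assumes "seminorm q"
  shows "convex {x. q (x - a) \<le> r}"
proof (rule convexI)
  fix x y :: 'a and u v :: real
  assume *: "x \<in> {x. q (x - a) \<le> r}" "y \<in> {x. q (x - a) \<le> r}" and uv: "0 \<le> u" "0 \<le> v" "u + v = 1"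
  have "(u *\<^sub>R x + v *\<^sub>R y) - (u + v) *\<^sub>R a = u *\<^sub>R (x - a) + v *\<^sub>R (y - a)"
    by (simp add: algebra_simps)
  then have "q ((u *\<^sub>R x + v *\<^sub>R y) - a) \<le> u * q (x - a) + v * q (y - a)"
    using seminorm_triangle[OF assms, of "u *\<^sub>R (x - a)" "v *\<^sub>R (y - a)"] uv
    by (simp add: seminorm_scale[OF assms])
  also have "\<dots> \<le> r"
    using * uv by (intro convex_bound_le) auto
  finally show "u *\<^sub>R x + v *\<^sub>R y \<in> {x. q (x - a) \<le> r}"
    by simp
qed

text \<open>
  Normal structure: the barycentre of the centres of a finite cover of \<open>F\<close> by balls of half the
  diameter is closer to every point of \<open>F\<close> than the diameter.
\<close>

lemma compact_seminorm_center:
  fixes F :: "'x::{real_vector, t2_space} set"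
  assumes Q: "locally_convex_space Q" "q \<in> Q"
    and F: "compact F" "F \<noteq> {}" "F \<subseteq> K" and K: "convex K"
    and d: "0 < d" "\<And>x y. x \<in> F \<Longrightarrow> y \<in> F \<Longrightarrow> q (x - y) \<le> d"
  obtains u r where "u \<in> K" "r < d" "\<And>y. y \<in> F \<Longrightarrow> q (u - y) \<le> r"
proof -
  have sq: "seminorm q"
    using Q by (rule locally_convex_space_seminorm)
  have "F \<subseteq> (\<Union>a\<in>F. {y. q (y - a) < d / 2})"
    using d(1) seminorm_zero[OF sq] by auto
  then obtain A where A: "A \<subseteq> F" "finite A" "F \<subseteq> (\<Union>a\<in>A. {y. q (y - a) < d / 2})"
    using compactE_image[OF F(1), of F "\<lambda>a. {y. q (y - a) < d / 2}"] open_seminorm_ball[OF Q]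
    by metis
  define n where "n = real (card A)"
  define u where "u = (\<Sum>a\<in>A. (1 / n) *\<^sub>R a)"
  \<comment> \<open>By the covering, each \<open>y\<close> in \<open>F\<close> has some centre
    \<open>b\<close> within \<open>d / 2\<close>, while the other \<open>n - 1\<close> centres are
    within \<open>d\<close>. The average of these bounds is \<open>r\<close>, which is below
    \<open>d\<close> because \<open>A\<close> is finite.\<close>
  define r where "r = (n * d - d / 2) / n"
  have "A \<noteq> {}"
    using A F by auto
  then have n: "n > 0"
    using A by (simp add: n_def card_gt_0_iff)
  have "u \<in> K"
    unfolding u_def using A n F by (intro convex_sum K) (auto simp: n_def)
  moreover have "r < d"
    using n d(1) by (simp add: r_def field_simps)
  moreover have "q (u - y) \<le> r" if y: "y \<in> F" for y
  proof -
    obtain b where b: "b \<in> A" "q (y - b) < d / 2"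
      using A y by auto
    have "u - y = (\<Sum>a\<in>A. (1 / n) *\<^sub>R (a - y))"
      using n by (simp add: u_def n_def scaleR_diff_right sum_subtractf sum_constant_scaleR)
    then have "q (u - y) \<le> (\<Sum>a\<in>A. (1 / n) * q (a - y))"
      using seminorm_sum_le[OF sq, of "\<lambda>a. (1 / n) *\<^sub>R (a - y)" A] n
      by (simp add: seminorm_scale[OF sq])
    also have "\<dots> = (\<Sum>a\<in>A. q (a - y)) / n"
      by (simp add: sum_divide_distrib)
    also have "(\<Sum>a\<in>A. q (a - y)) = q (b - y) + (\<Sum>a\<in>A - {b}. q (a - y))"
      using A b by (simp add: sum.remove)
    also have "\<dots> \<le> d / 2 + (\<Sum>a\<in>A - {b}. d)"
      using A b d(2) y seminorm_diff_commute[OF sq, of b y] by (intro add_mono sum_mono) auto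
    also have "(\<Sum>a\<in>A - {b}. d) = n * d - d"
      using A b n by (simp add: n_def of_nat_diff card_gt_0_iff algebra_simps Suc_leI)
    finally show ?thesis
      using n by (simp add: r_def divide_right_mono)
  qed
  ultimately show ?thesis
    using that by blast
qed


section \<open>Left reversible semigroups of nonexpansive maps\<close>

text \<open>Zorn's lemma for reverse inclusion; compactness keeps the intersection of a chain
  nonempty. The property \<open>P\<close> is left abstract because two kinds of minimal sets are
  needed below, invariant convex sets and invariant sets.\<close>

lemma compact_minimal_subset:
  fixes K :: "'a::t2_space set"
  assumes "compact K" "K \<noteq> {}" "P K"
    and Inter: "\<And>\<C>. \<C> \<noteq> {} \<Longrightarrow> (\<And>C. C \<in> \<C> \<Longrightarrow> P C) \<Longrightarrow> P (\<Inter>\<C>)"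
  obtains C where "compact C" "C \<noteq> {}" "C \<subseteq> K" "P C"
    "\<And>D. closed D \<Longrightarrow> D \<noteq> {} \<Longrightarrow> D \<subseteq> C \<Longrightarrow> P D \<Longrightarrow> D = C"
proof -
  define \<A> where "\<A> = {C. closed C \<and> C \<noteq> {} \<and> C \<subseteq> K \<and> P C}"
  have KA: "K \<in> \<A>"
    using assms compact_imp_closed by (auto simp: \<A>_def)
  have "\<exists>m\<in>\<A>. \<forall>a\<in>\<A>. a \<subseteq> m \<longrightarrow> a = m"
  proof (rule predicate_Zorn[where P = "\<lambda>a b. b \<subseteq> a"])
    show "partial_order_on \<A> (relation_of (\<lambda>a b. b \<subseteq> a) \<A>)"
      by (rule partial_order_on_relation_ofI) auto
  next
    fix \<C> assume ch: "\<C> \<in> Chains (relation_of (\<lambda>a b. b \<subseteq> a) \<A>)"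
    then have sub: "\<C> \<subseteq> \<A>" and lin: "\<And>C D. C \<in> \<C> \<Longrightarrow> D \<in> \<C> \<Longrightarrow> C \<subseteq> D \<or> D \<subseteq> C"
      by (auto simp: Chains_def relation_of_def)
    show "\<exists>u\<in>\<A>. \<forall>a\<in>\<C>. u \<subseteq> a"
    proof (cases "\<C> = {}")
      case True
      then show ?thesis using KA by auto
    next
      case False
      \<comment> \<open>In a chain, a finite intersection contains a member of the chain, and
        members are nonempty; this is the finite intersection property.\<close>
      have fin: "\<exists>D\<in>\<C>. D \<subseteq> \<Inter>B" if "finite B" "B \<subseteq> \<C>" for B
        using that
      proof (induction B rule: finite_induct)
        case (insert b B)
        then obtain D where "D \<in> \<C>" "D \<subseteq> \<Inter>B" by auto
        then show ?case
          using lin[of b D] insert.prems by auto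
      qed (use False in auto)
      have "K \<inter> \<Inter>\<C> \<noteq> {}"
      proof (rule compact_imp_fip[OF assms(1)])
        fix B assume "finite B" "B \<subseteq> \<C>"
        then obtain D where "D \<in> \<C>" "D \<subseteq> \<Inter>B" using fin by blast
        moreover from this have "D \<noteq> {}" "D \<subseteq> K"
          using sub by (auto simp: \<A>_def)
        ultimately show "K \<inter> \<Inter>B \<noteq> {}"
          by blast
      qed (use sub in \<open>auto simp: \<A>_def\<close>)
      moreover have "closed (\<Inter>\<C>)" "\<Inter>\<C> \<subseteq> K" "P (\<Inter>\<C>)"
        using sub False Inter[of \<C>] by (auto simp: \<A>_def)
      ultimately have "\<Inter>\<C> \<in> \<A>"
        by (auto simp: \<A>_def)
      then show ?thesis by blast
    qed
  qed
  then obtain C where C: "C \<in> \<A>" "\<And>D. D \<in> \<A> \<Longrightarrow> D \<subseteq> C \<Longrightarrow> D = C"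
    by blast
  show ?thesis
  proof
    show "compact C"
      using C(1) assms(1) by (metis (mono_tags, lifting) \<A>_def compact_Int_closed inf.absorb_iff2 mem_Collect_eq)
    show "D = C" if "closed D" "D \<noteq> {}" "D \<subseteq> C" "P D" for D
      using that C by (intro C(2)) (auto simp: \<A>_def)
  qed (use C(1) in \<open>auto simp: \<A>_def\<close>)
qed

text \<open>The intersection \<open>D\<close> of all images of \<open>F\<close> is again closed,
  nonempty and invariant, so minimality gives \<open>D = F\<close>, and then \<open>F\<close> lies
  in every image. Common right multiples provide both nonemptiness and invariance of
  \<open>D\<close>.\<close>

lemma minimal_invariant_image_eq:
  fixes F :: "'a::t2_space set"
  assumes F: "compact F" "F \<noteq> {}"
    and inv: "\<And>f. f \<in> M \<Longrightarrow> f ` F \<subseteq> F"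
    and minimal: "\<And>D. closed D \<Longrightarrow> D \<noteq> {} \<Longrightarrow> D \<subseteq> F \<Longrightarrow> \<forall>f\<in>M. f ` D \<subseteq> D \<Longrightarrow> D = F"
    and cont: "\<And>f. f \<in> M \<Longrightarrow> continuous_on F f"
    and comp: "\<And>f g. f \<in> M \<Longrightarrow> g \<in> M \<Longrightarrow> f \<circ> g \<in> M"
    and rev: "\<And>f g. f \<in> M \<Longrightarrow> g \<in> M \<Longrightarrow> \<exists>f'\<in>M. \<exists>g'\<in>M. \<forall>x\<in>F. f (f' x) = g (g' x)"
    and f: "f \<in> M"
  shows "f ` F = F"
proof -
  define D where "D = (\<Inter>g\<in>M. g ` F)"
  \<comment> \<open>The images are directed downwards: if \<open>b \<circ> b'\<close> and
    \<open>h \<circ> h'\<close> agree on \<open>F\<close>, the image of \<open>F\<close> under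
    \<open>h \<circ> h'\<close> lies in the images under both \<open>b\<close> and
    \<open>h\<close>.\<close>
  have fin: "\<exists>h\<in>M. h ` F \<subseteq> (\<Inter>g\<in>B. g ` F)" if "finite B" "B \<subseteq> M" for B
    using that
  proof (induction B rule: finite_induct)
    case (insert b B)
    then obtain h where h: "h \<in> M" "h ` F \<subseteq> (\<Inter>g\<in>B. g ` F)" by auto
    obtain b' h' where bh: "b' \<in> M" "h' \<in> M" "\<forall>x\<in>F. b (b' x) = h (h' x)"
      using rev[of b h] h insert.prems by auto
    have "(h \<circ> h') ` F \<subseteq> h ` F"
      using inv[OF bh(2)] by auto
    moreover have "(h \<circ> h') ` F \<subseteq> b ` F"
    proof
      fix z assume "z \<in> (h \<circ> h') ` F"
      then obtain x where "x \<in> F" "z = b (b' x)" using bh(3) by auto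
      then show "z \<in> b ` F" using inv[OF bh(1)] by auto
    qed
    ultimately have "(h \<circ> h') ` F \<subseteq> (\<Inter>g\<in>insert b B. g ` F)"
      using h(2) by auto
    then show ?case
      using comp[OF h(1) bh(2)] by blast
  qed (use f in auto)
  have closed_image: "closed (g ` F)" if "g \<in> M" for g
    using cont[OF that] F(1) by (intro compact_imp_closed compact_continuous_image)
  have "F \<inter> D \<noteq> {}"
    unfolding D_def
  proof (rule compact_imp_fip_image[OF F(1)])
    fix B assume "finite B" "B \<subseteq> M"
    then obtain h where h: "h \<in> M" "h ` F \<subseteq> (\<Inter>g\<in>B. g ` F)" using fin by blast
    then show "F \<inter> (\<Inter>g\<in>B. g ` F) \<noteq> {}"
      using inv[OF h(1)] F(2) by blast
  qed (rule closed_image)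
  moreover have "closed D"
    unfolding D_def using closed_image by auto
  moreover have "D \<subseteq> F"
    unfolding D_def using inv f by blast
  moreover have "\<forall>g\<in>M. g ` D \<subseteq> D"
  proof (intro ballI subsetI)
    fix g z assume g: "g \<in> M" and "z \<in> g ` D"
    then obtain x where x: "x \<in> D" "z = g x" by auto
    have "z \<in> h ` F" if h: "h \<in> M" for h
    proof -
      \<comment> \<open>Since \<open>x\<close> lies in every image, write \<open>x = g' y\<close>;
        then \<open>z = g (g' y) = h (h' y)\<close> is in the image of \<open>F\<close> under
        \<open>h\<close>.\<close>
      obtain g' h' where gh: "g' \<in> M" "h' \<in> M" "\<forall>x\<in>F. g (g' x) = h (h' x)"
        using rev[OF g h] by auto
      obtain y where "y \<in> F" "x = g' y"
        using x(1) gh(1) by (auto simp: D_def)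
      then show ?thesis
        using gh inv[OF gh(2)] x(2) by auto
    qed
    then show "z \<in> D" by (auto simp: D_def)
  qed
  ultimately have "D = F"
    using minimal by blast
  then show ?thesis
    using inv[OF f] f by (auto simp: D_def)
qed

lemma nonexpansive_imp_continuous_on:
  assumes "locally_convex_space Q"
    and "\<And>q x y. q \<in> Q \<Longrightarrow> x \<in> K \<Longrightarrow> y \<in> K \<Longrightarrow> q (f x - f y) \<le> q (x - y)"
  shows "continuous_on K f"
  unfolding continuous_on_def tendsto_locally_convex_iff[OF assms(1)]
proof (intro ballI)
  fix x q assume x: "x \<in> K" and q: "q \<in> Q"
  have sq: "seminorm q"
    using assms(1) q by (rule locally_convex_space_seminorm)
  have lim: "((\<lambda>y. q (y - x)) \<longlongrightarrow> 0) (at x within K)"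
    using tendsto_ident_at[of x K] q by (simp add: tendsto_locally_convex_iff[OF assms(1)])
  show "((\<lambda>y. q (f y - f x)) \<longlongrightarrow> 0) (at x within K)"
  proof (rule Lim_null_comparison[OF _ lim])
    show "\<forall>\<^sub>F y in at x within K. norm (q (f y - f x)) \<le> q (y - x)"
      using assms(2)[OF q _ x] seminorm_nonneg[OF sq] by (auto simp: eventually_at_filter)
  qed
qed

theorem left_reversible_nonexpansive_fixed_point:
  fixes K :: "'x::{real_vector, t2_space} set"
  assumes Q: "locally_convex_space Q"
    and K: "K \<noteq> {}" "compact K" "convex K"
    and maps: "\<And>f. f \<in> M \<Longrightarrow> f ` K \<subseteq> K"
    and nonexp: "\<And>f q x y. f \<in> M \<Longrightarrow> q \<in> Q \<Longrightarrow> x \<in> K \<Longrightarrow> y \<in> K \<Longrightarrow> q (f x - f y) \<le> q (x - y)"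
    and comp: "\<And>f g. f \<in> M \<Longrightarrow> g \<in> M \<Longrightarrow> f \<circ> g \<in> M"
    and rev: "\<And>f g. f \<in> M \<Longrightarrow> g \<in> M \<Longrightarrow> \<exists>f'\<in>M. \<exists>g'\<in>M. \<forall>x\<in>K. f (f' x) = g (g' x)"
  obtains x where "x \<in> K" "\<And>f. f \<in> M \<Longrightarrow> f x = x"
proof -
  \<comment> \<open>Two minimal sets are used. \<open>C\<close> is minimal among convex invariant
    sets and will be compared with an intersection of balls. \<open>F\<close> inside
    \<open>C\<close> is minimal without convexity, since images under the maps need not be convex;
    this makes every map send \<open>F\<close> onto itself.\<close>
  obtain C where C: "compact C" "C \<noteq> {}" "C \<subseteq> K" "convex C \<and> (\<forall>f\<in>M. f ` C \<subseteq> C)"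
    and Cmin: "\<And>D. closed D \<Longrightarrow> D \<noteq> {} \<Longrightarrow> D \<subseteq> C \<Longrightarrow> convex D \<and> (\<forall>f\<in>M. f ` D \<subseteq> D) \<Longrightarrow> D = C"
  proof (rule compact_minimal_subset[of K "\<lambda>C. convex C \<and> (\<forall>f\<in>M. f ` C \<subseteq> C)"])
    fix \<C> :: "'x set set"
    assume "\<And>C. C \<in> \<C> \<Longrightarrow> convex C \<and> (\<forall>f\<in>M. f ` C \<subseteq> C)"
    then show "convex (\<Inter>\<C>) \<and> (\<forall>f\<in>M. f ` \<Inter>\<C> \<subseteq> \<Inter>\<C>)"
      by (intro conjI convex_Inter) blast+
  qed (use K maps in auto)
  obtain F where F: "compact F" "F \<noteq> {}" "F \<subseteq> C" "\<forall>f\<in>M. f ` F \<subseteq> F"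
    and Fmin: "\<And>D. closed D \<Longrightarrow> D \<noteq> {} \<Longrightarrow> D \<subseteq> F \<Longrightarrow> \<forall>f\<in>M. f ` D \<subseteq> D \<Longrightarrow> D = F"
  proof (rule compact_minimal_subset[of C "\<lambda>C. \<forall>f\<in>M. f ` C \<subseteq> C"])
    fix \<C> :: "'x set set"
    assume "\<And>C. C \<in> \<C> \<Longrightarrow> \<forall>f\<in>M. f ` C \<subseteq> C"
    then show "\<forall>f\<in>M. f ` \<Inter>\<C> \<subseteq> \<Inter>\<C>"
      by blast
  qed (use C in auto)
  have FK: "F \<subseteq> K"
    using F C by auto
  have onto: "f ` F = F" if "f \<in> M" for f
  proof (rule minimal_invariant_image_eq[of F M])
    show "continuous_on F g" if "g \<in> M" for g
      using nonexp[OF that] FK by (intro nonexpansive_imp_continuous_on[OF Q]) blast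
    show "\<exists>f'\<in>M. \<exists>g'\<in>M. \<forall>x\<in>F. f (f' x) = g (g' x)" if "f \<in> M" "g \<in> M" for f g
      using rev[OF that] FK by blast
  qed (use F Fmin comp that in auto)
  have zero: "q (x - y) = 0" if q: "q \<in> Q" and xy: "x \<in> F" "y \<in> F" for q x y
  proof (rule ccontr)
    assume nz: "q (x - y) \<noteq> 0"
    have sq: "seminorm q"
      using Q q by (rule locally_convex_space_seminorm)
    \<comment> \<open>\<open>d\<close> is the \<open>q\<close>-diameter of \<open>F\<close>, finite
      by compactness. If it were positive, normal structure would give a point of \<open>C\<close>
      whose \<open>q\<close>-distances to \<open>F\<close> are bounded by some
      \<open>r < d\<close>.\<close>
    define d where "d = (SUP p\<in>F \<times> F. q (fst p - snd p))"
    have bdd: "bdd_above ((\<lambda>p. q (fst p - snd p)) ` (F \<times> F))"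
    proof -
      have "compact ((\<lambda>z. q (z - x)) ` F)"
        by (intro compact_continuous_image continuous_on_seminorm_diff[OF Q q] F)
      then have "bdd_above ((\<lambda>z. q (z - x)) ` F)"
        by (intro bounded_imp_bdd_above compact_imp_bounded)
      then obtain B where B: "\<And>z. z \<in> F \<Longrightarrow> q (z - x) \<le> B"
        by (auto simp: bdd_above_def)
      have "q (u - v) \<le> B + B" if "u \<in> F" "v \<in> F" for u v
        using seminorm_diff_triangle[OF sq, of u v x] seminorm_diff_commute[OF sq, of x v]
          B[OF that(1)] B[OF that(2)] by simp
      then show ?thesis
        by (intro bdd_aboveI2[where M = "B + B"]) auto
    qed
    have d: "q (u - v) \<le> d" if "u \<in> F" "v \<in> F" for u v
      using cSUP_upper[OF _ bdd, of "(u, v)"] that by (simp add: d_def)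
    have "0 < d"
      using d[OF xy] nz seminorm_nonneg[OF sq, of "x - y"] by linarith
    then obtain u r where u: "u \<in> C" "r < d" "\<And>y. y \<in> F \<Longrightarrow> q (u - y) \<le> r"
      using compact_seminorm_center[OF Q q F(1,2,3), of d] C(4) d by blast
    \<comment> \<open>The set of all \<open>r\<close>-centres of \<open>F\<close> in
      \<open>C\<close>. It is closed, convex and contains \<open>u\<close>; once it is known to be
      invariant, minimality of \<open>C\<close> applies.\<close>
    define D where "D = C \<inter> (\<Inter>y\<in>F. {z. q (z - y) \<le> r})"
    have "D = C"
    proof (rule Cmin)
      show "closed D"
        unfolding D_def using C(1) closed_seminorm_cball[OF Q q]
        by (intro closed_Int closed_INT ballI) (auto intro: compact_imp_closed)
      show "D \<noteq> {}"
        using u by (auto simp: D_def)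
      have "convex D"
        unfolding D_def using C(4) by (intro convex_Int convex_INT convex_seminorm_cball[OF sq]) auto
      moreover have "f z \<in> D" if f: "f \<in> M" and z: "z \<in> D" for f z
      proof -
        have "q (f z - y) \<le> r" if "y \<in> F" for y
        proof -
          \<comment> \<open>Surjectivity of \<open>f\<close> on \<open>F\<close> is essential here:
            every \<open>y\<close> in \<open>F\<close> is some \<open>f w\<close>, so
            nonexpansiveness carries the bound from \<open>z\<close> to \<open>f z\<close>.\<close>
          obtain w where w: "w \<in> F" "y = f w"
            using onto[OF f] \<open>y \<in> F\<close> by blast
          have "z \<in> C" "q (z - w) \<le> r"
            using z w by (auto simp: D_def)
          moreover from this have "q (f z - f w) \<le> q (z - w)"
            using w FK C(3) by (intro nonexp[OF f q]) auto
          ultimately show ?thesis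
            using w by simp
        qed
        moreover have "f z \<in> C"
          using z C(4) f unfolding D_def by blast
        ultimately show ?thesis
          by (auto simp: D_def)
      qed
      ultimately show "convex D \<and> (\<forall>f\<in>M. f ` D \<subseteq> D)"
        by blast
    qed (simp add: D_def)
    \<comment> \<open>As \<open>F \<subseteq> C = D\<close>, every point of \<open>F\<close> is
      itself an \<open>r\<close>-centre of \<open>F\<close>, so the diameter would be at most
      \<open>r < d\<close>.\<close>
    then have "q (a - b) \<le> r" if "a \<in> F" "b \<in> F" for a b
      using that F(3) by (auto simp: D_def)
    then have "d \<le> r"
      unfolding d_def using F(2) by (intro cSUP_least) auto
    then show False
      using u(2) by simp
  qed
  obtain x where x: "x \<in> F"
    using F(2) by blast
  have "f x = x" if "f \<in> M" for f
    using F(4) that x by (intro locally_convex_space_eqI[OF Q] zero) auto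
  then show ?thesis
    using that x FK by blast
qed


section \<open>Limits of an action along the closed left ideals\<close>

text \<open>Function types carry the product topology, so limits of maps are pointwise
  limits.\<close>

lemma tendsto_fun_iff: "(f \<longlongrightarrow> l) F \<longleftrightarrow> (\<forall>i. ((\<lambda>a. f a i) \<longlongrightarrow> l i) F)"
  using limitin_componentwise[of "\<lambda>_. euclidean" UNIV f l F]
  by (simp add: euclidean_product_topology)

text \<open>The filter form of passing to a convergent subnet: \<open>G\<close> adds to
  \<open>F\<close> the preimages of the neighbourhoods of a cluster point \<open>c\<close>, and
  stays proper because \<open>c\<close> is a cluster point.\<close>

lemma compact_filter_cluster:
  assumes "compact C" "F \<noteq> bot" "\<forall>\<^sub>F a in F. f a \<in> C"
  obtains c G where "c \<in> C" "G \<le> F" "G \<noteq> bot" "(f \<longlongrightarrow> c) G"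
proof -
  have "filtermap f F \<noteq> bot" "\<forall>\<^sub>F x in filtermap f F. x \<in> C"
    using assms by (simp_all add: filtermap_bot_iff eventually_filtermap)
  then obtain c where c: "c \<in> C" "inf (nhds c) (filtermap f F) \<noteq> bot"
    using assms(1) unfolding compact_filter by blast
  define G where "G = inf F (filtercomap f (nhds c))"
  have "G \<noteq> bot"
  proof
    assume "G = bot"
    then obtain P R where P: "eventually P F" "eventually R (nhds c)" "\<And>a. P a \<Longrightarrow> \<not> R (f a)"
      unfolding G_def trivial_limit_def eventually_inf eventually_filtercomap by metis
    have "\<forall>\<^sub>F x in filtermap f F. \<not> R x"
      unfolding eventually_filtermap using P(1) by (rule eventually_mono) (rule P(3))
    then have "\<forall>\<^sub>F x in inf (nhds c) (filtermap f F). False"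
      unfolding eventually_inf using P(2) by blast
    then show False
      using c(2) by (simp add: trivial_limit_def)
  qed
  moreover have "(f \<longlongrightarrow> c) G"
    unfolding G_def by (rule filterlim_mono[OF filterlim_filtercomap order_refl]) simp
  moreover have "G \<le> F"
    by (simp add: G_def)
  ultimately show ?thesis
    using that c(1) by blast
qed

section \<open>Left and right ideals under translation, intersection and closure\<close>

lemma left_ideal_mult_right: "left_ideal I \<Longrightarrow> left_ideal ((\<lambda>s. s * t) ` I)"
  by (auto simp: left_ideal_def mult.assoc[symmetric])

lemma left_ideal_Int: "left_ideal I \<Longrightarrow> left_ideal J \<Longrightarrow> I \<inter> J \<noteq> {} \<Longrightarrow> left_ideal (I \<inter> J)"
  by (auto simp: left_ideal_def)

lemma left_ideal_closure:
  fixes I :: "'s::semitopological_semigroup set"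
  assumes "left_ideal I"
  shows "left_ideal (closure I)"
proof -
  have "(\<lambda>i. s * i) ` closure I \<subseteq> closure I" for s
    using assms closure_subset[of I]
    by (intro image_closure_subset continuous_on_subset[OF continuous_on_translations(1)])
      (auto simp: left_ideal_def)
  then show ?thesis
    using assms closure_subset[of I] by (fastforce simp: left_ideal_def)
qed

lemma right_ideal_closure:
  fixes I :: "'s::semitopological_semigroup set"
  assumes "right_ideal I"
  shows "right_ideal (closure I)"
proof -
  have "(\<lambda>i. i * s) ` closure I \<subseteq> closure I" for s
    using assms closure_subset[of I]
    by (intro image_closure_subset continuous_on_subset[OF continuous_on_translations(2)])
      (auto simp: right_ideal_def)
  then show ?thesis
    using assms closure_subset[of I] by (fastforce simp: right_ideal_def)
qed

text \<open>The sense in which \<open>s\<close> goes to infinity in the semigroup. Only closed left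
  ideals are used, because right reversibility makes exactly these meet pairwise; they then form a
  base of a proper filter.\<close>

definition left_ideal_filter :: "'s::semitopological_semigroup filter" where
  "left_ideal_filter = (INF L\<in>{L. closed L \<and> left_ideal L}. principal L)"

lemma eventually_left_ideal_filterI:
  "closed L \<Longrightarrow> left_ideal L \<Longrightarrow> \<forall>\<^sub>F s in left_ideal_filter. s \<in> L"
  unfolding left_ideal_filter_def by (intro eventually_INF1) (auto simp: eventually_principal)

lemma eventually_left_ideal_filter:
  assumes "right_reversible TYPE('s::semitopological_semigroup)"
  shows "eventually P (left_ideal_filter :: 's filter) \<longleftrightarrow>
    (\<exists>L. closed L \<and> left_ideal L \<and> (\<forall>s\<in>L. P s))"
proof -
  have "eventually P (left_ideal_filter :: 's filter) \<longleftrightarrow>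
      (\<exists>L\<in>{L. closed L \<and> left_ideal L}. eventually P (principal L))"
    unfolding left_ideal_filter_def
  proof (rule eventually_INF_base)
    have "UNIV \<in> {L :: 's set. closed L \<and> left_ideal L}"
      by (simp add: left_ideal_def)
    then show "{L :: 's set. closed L \<and> left_ideal L} \<noteq> {}"
      by blast
  next
    fix I J :: "'s set"
    assume "I \<in> {L. closed L \<and> left_ideal L}" "J \<in> {L. closed L \<and> left_ideal L}"
    then have "I \<inter> J \<in> {L. closed L \<and> left_ideal L}"
      using assms by (auto simp: right_reversible_def intro!: left_ideal_Int)
    then show "\<exists>L\<in>{L. closed L \<and> left_ideal L}. principal L \<le> inf (principal I) (principal J)"
      by (intro bexI[of _ "I \<inter> J"]) auto
  qed
  then show ?thesis
    by (auto simp: eventually_principal)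
qed

lemma left_ideal_filter_neq_bot:
  assumes "right_reversible TYPE('s::semitopological_semigroup)"
  shows "(left_ideal_filter :: 's filter) \<noteq> bot"
  unfolding trivial_limit_def eventually_left_ideal_filter[OF assms] by (auto simp: left_ideal_def)

text \<open>Under right reversibility these are the \<open>K\<close>-valued cluster points of
  \<open>act\<close> along \<open>left_ideal_filter\<close> for pointwise convergence. Written as an
  intersection of closures inside a product of copies of \<open>K\<close>, the set is visibly
  compact when \<open>K\<close> is.\<close>

definition left_ideal_limits ::
    "('s::semitopological_semigroup \<Rightarrow> 'x::topological_space \<Rightarrow> 'x) \<Rightarrow> 'x set \<Rightarrow> ('x \<Rightarrow> 'x) set" where
  "left_ideal_limits act K =
     (UNIV \<rightarrow> K) \<inter> (\<Inter>L\<in>{L. closed L \<and> left_ideal L}. closure (act ` L))"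

text \<open>Tychonoff's theorem, for the product of copies of \<open>K\<close>.\<close>

lemma compact_funspace:
  fixes K :: "'x::topological_space set"
  assumes "compact K"
  shows "compact (UNIV \<rightarrow> K :: ('i \<Rightarrow> 'x) set)"
proof -
  have "compactin (product_topology (\<lambda>_::'i. euclidean) UNIV) (PiE UNIV (\<lambda>_. K))"
    using assms by (simp add: compactin_PiE)
  then show ?thesis
    by (simp add: euclidean_product_topology PiE_UNIV_domain)
qed

lemma left_ideal_limits_compact: "compact K \<Longrightarrow> compact (left_ideal_limits act K)"
  unfolding left_ideal_limits_def
  by (intro compact_Int_closed compact_funspace closed_INT ballI closed_closure)

lemma tendsto_in_left_ideal_limits:
  assumes "F \<noteq> bot" "(f \<longlongrightarrow> m) F" "\<forall>\<^sub>F a in F. f a \<in> left_ideal_limits act K" "range m \<subseteq> K"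
  shows "m \<in> left_ideal_limits act K"
proof -
  have "m \<in> closure (act ` L)" if "closed L" "left_ideal L" for L
  proof (rule Lim_in_closed_set[OF closed_closure _ assms(1,2)])
    show "\<forall>\<^sub>F a in F. f a \<in> closure (act ` L)"
      using assms(3) by (rule eventually_mono) (use that in \<open>auto simp: left_ideal_limits_def\<close>)
  qed
  then show ?thesis
    using assms(4) by (auto simp: left_ideal_limits_def)
qed

text \<open>Every neighbourhood of \<open>m\<close> meets the image of every closed left ideal, and
  these ideals form a filter base; hence adding the preimages of the neighbourhoods of
  \<open>m\<close> keeps the filter proper.\<close>

lemma left_ideal_limitsE:
  fixes act :: "'s::semitopological_semigroup \<Rightarrow> 'x::topological_space \<Rightarrow> 'x"
  assumes "right_reversible TYPE('s)" "m \<in> left_ideal_limits act K"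
  obtains F where "F \<noteq> bot" "F \<le> left_ideal_filter" "(act \<longlongrightarrow> m) F"
proof -
  define F where "F = inf left_ideal_filter (filtercomap act (nhds m))"
  have "F \<noteq> bot"
  proof
    assume "F = bot"
    then obtain P R where P: "eventually P left_ideal_filter" "eventually R (nhds m)"
        "\<And>s. P s \<Longrightarrow> \<not> R (act s)"
      unfolding F_def trivial_limit_def eventually_inf eventually_filtercomap by metis
    obtain L where L: "closed L" "left_ideal L" "\<forall>s\<in>L. P s"
      using P(1) unfolding eventually_left_ideal_filter[OF assms(1)] by blast
    obtain U where U: "open U" "m \<in> U" "\<forall>x\<in>U. R x"
      using P(2) unfolding eventually_nhds by blast
    have "m \<in> closure (act ` L)"
      using assms(2) L by (auto simp: left_ideal_limits_def)
    then have "act ` L \<inter> U \<noteq> {}"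
      using U(1,2) open_Int_closure_eq_empty[of U "act ` L"] by blast
    then show False
      using L(3) U(3) P(3) by blast
  qed
  moreover have "(act \<longlongrightarrow> m) F"
    unfolding F_def by (rule filterlim_mono[OF filterlim_filtercomap order_refl]) simp
  moreover have "F \<le> left_ideal_filter"
    by (simp add: F_def)
  ultimately show ?thesis
    using that by blast
qed

lemma left_ideal_limits_nonempty:
  fixes act :: "'s::semitopological_semigroup \<Rightarrow> 'x::topological_space \<Rightarrow> 'x"
  assumes "right_reversible TYPE('s)" "compact K" "\<And>s x. act s x \<in> K"
  shows "left_ideal_limits act K \<noteq> {}"
proof -
  obtain m F where m: "m \<in> UNIV \<rightarrow> K" and F: "F \<le> left_ideal_filter" "F \<noteq> bot" "(act \<longlongrightarrow> m) F"
    by (rule compact_filter_cluster[OF compact_funspace[OF assms(2)]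
          left_ideal_filter_neq_bot[OF assms(1)], of act])
      (use assms(3) in \<open>auto intro: always_eventually\<close>)
  have "m \<in> closure (act ` L)" if "closed L" "left_ideal L" for L
  proof (rule Lim_in_closed_set[OF closed_closure _ F(2,3)])
    show "\<forall>\<^sub>F s in F. act s \<in> closure (act ` L)"
      using filter_leD[OF F(1) eventually_left_ideal_filterI[OF that]]
      by (rule eventually_mono) (auto intro: closure_subset[THEN subsetD])
  qed
  then show ?thesis
    using m unfolding left_ideal_limits_def by blast
qed

text \<open>
  In the following locale the maps are defined on the whole space, with values in \<open>K\<close>; an action on
  \<open>K\<close> is brought into this form by composing with any map that fixes \<open>K\<close> pointwise and has
  values in \<open>K\<close>.
\<close>

locale reversible_compact_action =
  fixes act :: "'s::semitopological_semigroup \<Rightarrow> 'x::{real_vector, t2_space} \<Rightarrow> 'x"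
    and K :: "'x set" and Q :: "('x \<Rightarrow> real) set"
  assumes reversible: "reversible TYPE('s)"
    and lcs: "locally_convex_space Q"
    and compact: "compact K"
    and act_mem: "act s x \<in> K"
    and act_mult: "act (s * t) x = act s (act t x)"
    and act_continuous: "continuous_on K (act s)"
    and orbit_continuous: "continuous_on UNIV (\<lambda>s. act s x)"
    and nonexpansive: "super_asymptotically_separately_nonexpansive Q act K"
begin

section \<open>The limit maps as a semigroup of nonexpansive maps\<close>

abbreviation M where "M \<equiv> left_ideal_limits act K"

lemma right_rev: "right_reversible TYPE('s)" and left_rev: "left_reversible TYPE('s)"
  using reversible by (simp_all add: reversible_def)

lemma limits_nonempty: "M \<noteq> {}"
  using left_ideal_limits_nonempty[OF right_rev compact, of act] act_mem by blast

lemma limits_mem: "m \<in> M \<Longrightarrow> m x \<in> K"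
  by (auto simp: left_ideal_limits_def)

lemma tendsto_act: "(f \<longlongrightarrow> l) F \<Longrightarrow> (\<And>a. f a \<in> K) \<Longrightarrow> l \<in> K \<Longrightarrow> ((\<lambda>a. act s (f a)) \<longlongrightarrow> act s l) F"
  by (rule continuous_on_tendsto_compose[OF act_continuous]) auto

lemma eventually_nonexpansive:
  assumes "x \<in> K" "q \<in> Q"
  shows "\<forall>\<^sub>F s in left_ideal_filter. \<forall>y\<in>K. q (act s x - act s y) \<le> q (x - y)"
proof -
  \<comment> \<open>An arbitrary element. The right translate of \<open>I\<close> by
    \<open>t\<close> is again a left ideal, and so is its closure; the inequality extends to the
    closure because orbits are continuous in \<open>s\<close>.\<close>
  define t :: 's where "t = undefined"
  obtain I where I: "left_ideal I"
      "\<forall>s\<in>I. \<forall>y\<in>K. q (act (s * t) x - act (s * t) y) \<le> q (x - y)"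
    using nonexpansive assms unfolding super_asymptotically_separately_nonexpansive_def by blast
  define L where "L = closure ((\<lambda>s. s * t) ` I)"
  have "q (act s x - act s y) \<le> q (x - y)" if "s \<in> L" "y \<in> K" for s y
  proof -
    have "continuous_on UNIV (\<lambda>s. q (act s x - act s y))"
      unfolding continuous_on_def
      using orbit_continuous[of x] orbit_continuous[of y]
      by (intro ballI tendsto_seminorm_diff[OF lcs assms(2)]) (auto simp: continuous_on_def)
    then have "closed {s. q (act s x - act s y) \<le> q (x - y)}"
      by (intro closed_Collect_le continuous_on_const)
    then have "L \<subseteq> {s. q (act s x - act s y) \<le> q (x - y)}"
      unfolding L_def using I(2) that(2) by (intro closure_minimal) auto
    then show ?thesis
      using that(1) by blast
  qed
  moreover have "\<forall>\<^sub>F s in left_ideal_filter. s \<in> L"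
    unfolding L_def
    by (intro eventually_left_ideal_filterI closed_closure left_ideal_closure left_ideal_mult_right I(1))
  ultimately show ?thesis
    by (auto elim!: eventually_mono)
qed

text \<open>The left ideal on which the inequality holds varies with \<open>x\<close> and
  \<open>q\<close>, but each such inequality holds eventually along the filter and so survives in
  the limit.\<close>

lemma limits_nonexpansive:
  assumes m: "m \<in> M" and q: "q \<in> Q" and xy: "x \<in> K" "y \<in> K"
  shows "q (m x - m y) \<le> q (x - y)"
proof -
  obtain F where F: "F \<noteq> bot" "F \<le> left_ideal_filter" "(act \<longlongrightarrow> m) F"
    using left_ideal_limitsE[OF right_rev m] .
  have "((\<lambda>s. q (act s x - act s y)) \<longlongrightarrow> q (m x - m y)) F"
    using F(3) by (intro tendsto_seminorm_diff[OF lcs q]) (auto simp: tendsto_fun_iff)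
  then show ?thesis
    using filter_leD[OF F(2) eventually_nonexpansive[OF xy(1) q]] xy(2) F(1)
    by (intro tendsto_upperbound) (auto elim: eventually_mono)
qed

lemma act_limits: "m \<in> M \<Longrightarrow> act s \<circ> m \<in> M"
proof -
  assume m: "m \<in> M"
  obtain F where F: "F \<noteq> bot" "F \<le> left_ideal_filter" "(act \<longlongrightarrow> m) F"
    using left_ideal_limitsE[OF right_rev m] .
  \<comment> \<open>With \<open>u\<close> in a left ideal \<open>L\<close>, \<open>s * u\<close>
    stays in \<open>L\<close>, so the limit of \<open>act (s * u)\<close> is still in the closure of
    the image of \<open>L\<close>.\<close>
  have lim: "((\<lambda>u. act (s * u)) \<longlongrightarrow> act s \<circ> m) F"
    using F(3) by (auto simp: tendsto_fun_iff act_mult act_mem limits_mem[OF m] intro!: tendsto_act)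
  have "act s \<circ> m \<in> closure (act ` L)" if L: "closed L" "left_ideal L" for L
  proof (rule Lim_in_closed_set[OF closed_closure _ F(1) lim])
    show "\<forall>\<^sub>F u in F. act (s * u) \<in> closure (act ` L)"
      using filter_leD[OF F(2) eventually_left_ideal_filterI[OF L]]
      by (rule eventually_mono) (use L in \<open>auto simp: left_ideal_def intro: closure_subset[THEN subsetD]\<close>)
  qed
  then show ?thesis
    by (auto simp: left_ideal_limits_def act_mem)
qed

text \<open>\<open>m \<circ> n\<close> is the pointwise limit of the maps
  \<open>act s \<circ> n\<close>, which are in \<open>M\<close> by \<open>act_limits\<close>, and
  \<open>M\<close> is closed under limits with values in \<open>K\<close>.\<close>

lemma limits_comp:
  assumes m: "m \<in> M" and n: "n \<in> M"
  shows "m \<circ> n \<in> M"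
proof -
  obtain F where F: "F \<noteq> bot" "F \<le> left_ideal_filter" "(act \<longlongrightarrow> m) F"
    using left_ideal_limitsE[OF right_rev m] .
  show ?thesis
  proof (rule tendsto_in_left_ideal_limits[OF F(1)])
    show "((\<lambda>s. act s \<circ> n) \<longlongrightarrow> m \<circ> n) F"
      using F(3) by (simp add: tendsto_fun_iff)
  qed (use act_limits[OF n] limits_mem[OF m] in auto)
qed

section \<open>Left reversibility of the limit maps\<close>

lemma closure_right_translate:
  assumes a: "a \<in> closure (range (\<lambda>u. s * u))" and m: "m \<in> M"
  obtains n where "n \<in> M" "act a \<circ> m = act s \<circ> n"
proof -
  \<comment> \<open>The filter of those \<open>u\<close> for which \<open>s * u\<close> is close to
    \<open>a\<close>. Although \<open>a\<close> need not be a multiple of \<open>s\<close>, a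
    cluster point \<open>n\<close> of \<open>act u \<circ> m\<close> in the compact set
    \<open>M\<close> plays the part of the quotient applied after \<open>m\<close>.\<close>
  define F where "F = filtercomap (\<lambda>u. s * u) (nhds a)"
  have "F \<noteq> bot"
    unfolding F_def
  proof (rule filtercomap_neq_bot)
    fix P assume "eventually P (nhds a)"
    then obtain U where U: "open U" "a \<in> U" "\<forall>x\<in>U. P x"
      unfolding eventually_nhds by blast
    then have "range (\<lambda>u. s * u) \<inter> U \<noteq> {}"
      using a open_Int_closure_eq_empty[of U "range (\<lambda>u. s * u)"] by blast
    then show "\<exists>u. P (s * u)"
      using U(3) by blast
  qed
  then obtain n G where n: "n \<in> M" and G: "G \<le> F" "G \<noteq> bot" "((\<lambda>u. act u \<circ> m) \<longlongrightarrow> n) G"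
  proof (rule compact_filter_cluster[OF left_ideal_limits_compact[OF compact, of act]])
    show "\<forall>\<^sub>F u in F. act u \<circ> m \<in> M"
      using act_limits[OF m] by (intro always_eventually allI)
  qed
  have lim_a: "((\<lambda>u. s * u) \<longlongrightarrow> a) G"
    using G(1) unfolding F_def by (rule filterlim_mono[OF filterlim_filtercomap order_refl])
  \<comment> \<open>The net \<open>act (s * u) (m x)\<close> has both values as limits: one by
    continuity of the orbit of \<open>m x\<close>, the other by continuity of \<open>act s\<close>
    on \<open>K\<close>.\<close>
  have "act a (m x) = act s (n x)" for x
  proof (rule tendsto_unique[OF G(2)])
    show "((\<lambda>u. act (s * u) (m x)) \<longlongrightarrow> act a (m x)) G"
      using continuous_on_tendsto_compose[OF orbit_continuous lim_a] by simp
    show "((\<lambda>u. act (s * u) (m x)) \<longlongrightarrow> act s (n x)) G"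
      using G(3) unfolding act_mult
      by (intro tendsto_act) (simp_all add: tendsto_fun_iff act_mem limits_mem[OF n])
  qed
  then show ?thesis
    using that n by (auto simp: fun_eq_iff)
qed

text \<open>Left reversibility gives a common point \<open>a\<close> of the closures of the right
  ideals generated by left multiplication with \<open>s\<close> and \<open>t\<close>;
  \<open>act a \<circ> m\<close> then factors through both \<open>act s\<close> and
  \<open>act t\<close>.\<close>

lemma limits_common_multiple_act:
  obtains n n' where "n \<in> M" "n' \<in> M" "act s \<circ> n = act t \<circ> n'"
proof -
  obtain m where m: "m \<in> M"
    using limits_nonempty by blast
  have "right_ideal (range (\<lambda>u. r * u))" for r :: 's
    by (auto simp: right_ideal_def mult.assoc)
  then have "closure (range (\<lambda>u. s * u)) \<inter> closure (range (\<lambda>u. t * u)) \<noteq> {}"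
    using left_rev right_ideal_closure closed_closure unfolding left_reversible_def by blast
  then obtain a where a: "a \<in> closure (range (\<lambda>u. s * u))" "a \<in> closure (range (\<lambda>u. t * u))"
    by blast
  obtain n where "n \<in> M" "act a \<circ> m = act s \<circ> n"
    using closure_right_translate[OF a(1) m] .
  moreover obtain n' where "n' \<in> M" "act a \<circ> m = act t \<circ> n'"
    using closure_right_translate[OF a(2) m] .
  ultimately show ?thesis
    using that by metis
qed

text \<open>
  The separate nonexpansiveness is centred at the limit point \<open>n x\<close> but holds for all second
  arguments; this replaces the joint continuity that is missing for the action.
\<close>

lemma tendsto_act_joint:
  assumes f: "filterlim f left_ideal_filter F" "((\<lambda>a. act (f a)) \<longlongrightarrow> m) F"
    and g: "((\<lambda>a. g a) \<longlongrightarrow> n) F" "\<And>a x. g a x \<in> K" and n: "\<And>x. n x \<in> K"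
  shows "((\<lambda>a. act (f a) (g a x)) \<longlongrightarrow> m (n x)) F"
  unfolding tendsto_locally_convex_iff[OF lcs]
proof
  fix q assume q: "q \<in> Q"
  have sq: "seminorm q"
    using lcs q by (rule locally_convex_space_seminorm)
  have "((\<lambda>a. g a x) \<longlongrightarrow> n x) F" "((\<lambda>a. act (f a) (n x)) \<longlongrightarrow> m (n x)) F"
    using f(2) g(1) by (simp_all add: tendsto_fun_iff)
  then have "((\<lambda>a. q (g a x - n x)) \<longlongrightarrow> 0) F" "((\<lambda>a. q (act (f a) (n x) - m (n x))) \<longlongrightarrow> 0) F"
    using q by (simp_all add: tendsto_locally_convex_iff[OF lcs])
  then have lim: "((\<lambda>a. q (g a x - n x) + q (act (f a) (n x) - m (n x))) \<longlongrightarrow> 0) F"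
    using tendsto_add by fastforce
  have "\<forall>\<^sub>F a in F. \<forall>y\<in>K. q (act (f a) (n x) - act (f a) y) \<le> q (n x - y)"
    using f(1) eventually_nonexpansive[OF n q] by (rule filterlim_iff[THEN iffD1, rule_format])
  then have "\<forall>\<^sub>F a in F. norm (q (act (f a) (g a x) - m (n x)))
      \<le> q (g a x - n x) + q (act (f a) (n x) - m (n x))"
  proof (rule eventually_mono)
    fix a assume "\<forall>y\<in>K. q (act (f a) (n x) - act (f a) y) \<le> q (n x - y)"
    then have "q (act (f a) (n x) - act (f a) (g a x)) \<le> q (n x - g a x)"
      using g(2) by blast
    then show "norm (q (act (f a) (g a x) - m (n x)))
      \<le> q (g a x - n x) + q (act (f a) (n x) - m (n x))"
      using seminorm_diff_triangle[OF sq, of "act (f a) (g a x)" "m (n x)" "act (f a) (n x)"]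
        seminorm_nonneg[OF sq, of "act (f a) (g a x) - m (n x)"]
        seminorm_diff_commute[OF sq, of "n x" "g a x"]
        seminorm_diff_commute[OF sq, of "act (f a) (n x)" "act (f a) (g a x)"] by simp
  qed
  then show "((\<lambda>a. q (act (f a) (g a x) - m (n x))) \<longlongrightarrow> 0) F"
    using lim by (rule Lim_null_comparison)
qed

text \<open>Approximate \<open>m\<close> by \<open>act s\<close> and \<open>m'\<close> by
  \<open>act t\<close>, take common multiples \<open>act s \<circ> n = act t \<circ> n'\<close> for
  each pair, and let \<open>(n, n')\<close> cluster in the compact set \<open>M \<times> M\<close>.
  Both sides converge by \<open>tendsto_act_joint\<close>.\<close>

lemma limits_left_reversible:
  assumes m: "m \<in> M" and m': "m' \<in> M"
  shows "\<exists>n\<in>M. \<exists>n'\<in>M. m \<circ> n = m' \<circ> n'"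
proof -
  obtain F where F: "F \<noteq> bot" "F \<le> left_ideal_filter" "(act \<longlongrightarrow> m) F"
    using left_ideal_limitsE[OF right_rev m] .
  obtain F' where F': "F' \<noteq> bot" "F' \<le> left_ideal_filter" "(act \<longlongrightarrow> m') F'"
    using left_ideal_limitsE[OF right_rev m'] .
  have "\<forall>p. \<exists>n. fst n \<in> M \<and> snd n \<in> M \<and> act (fst p) \<circ> fst n = act (snd p) \<circ> snd n"
    using limits_common_multiple_act by (metis fst_conv snd_conv)
  then obtain N where N: "\<And>p. fst (N p) \<in> M" "\<And>p. snd (N p) \<in> M"
      "\<And>p. act (fst p) \<circ> fst (N p) = act (snd p) \<circ> snd (N p)"
    by metis
  \<comment> \<open>The product filter lets \<open>s\<close> and \<open>t\<close> run independently
    along \<open>F\<close> and \<open>F'\<close>; the refinement \<open>G\<close> makes the chosen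
    pairs of multiples converge as well.\<close>
  obtain c G where c: "c \<in> M \<times> M" and G: "G \<le> F \<times>\<^sub>F F'" "G \<noteq> bot" "(N \<longlongrightarrow> c) G"
  proof (rule compact_filter_cluster[of "M \<times> M" "F \<times>\<^sub>F F'" N])
    show "compact (M \<times> M)"
      by (intro compact_Times left_ideal_limits_compact compact)
    show "F \<times>\<^sub>F F' \<noteq> bot"
      using F(1) F'(1) by (simp add: prod_filter_eq_bot)
    show "\<forall>\<^sub>F p in F \<times>\<^sub>F F'. N p \<in> M \<times> M"
      using N(1,2) by (intro always_eventually) (auto simp: mem_Times_iff)
  qed
  have lim: "((\<lambda>p. fst (N p)) \<longlongrightarrow> fst c) G" "((\<lambda>p. snd (N p)) \<longlongrightarrow> snd c) G"
    using G(3) by (auto intro: tendsto_fst tendsto_snd)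
  have cM: "fst c \<in> M" "snd c \<in> M"
    using c by auto
  have fst: "filterlim fst F G" and snd: "filterlim snd F' G"
    using filterlim_mono[OF filterlim_fst order_refl G(1)]
      filterlim_mono[OF filterlim_snd order_refl G(1)] by auto
  have "m (fst c x) = m' (snd c x)" for x
  proof (rule tendsto_unique[OF G(2)])
    show "((\<lambda>p. act (fst p) (fst (N p) x)) \<longlongrightarrow> m (fst c x)) G"
      using filterlim_mono[OF fst F(2) order_refl] filterlim_compose[OF F(3) fst] lim(1) N(1) cM(1)
      by (intro tendsto_act_joint limits_mem)
    have "((\<lambda>p. act (snd p) (snd (N p) x)) \<longlongrightarrow> m' (snd c x)) G"
      using filterlim_mono[OF snd F'(2) order_refl] filterlim_compose[OF F'(3) snd] lim(2) N(2) cM(2)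
      by (intro tendsto_act_joint limits_mem)
    then show "((\<lambda>p. act (fst p) (fst (N p) x)) \<longlongrightarrow> m' (snd c x)) G"
      using N(3) by (simp add: fun_eq_iff)
  qed
  then show ?thesis
    using cM by (intro bexI[of _ "fst c"] bexI[of _ "snd c"]) auto
qed

theorem common_fixed_point:
  assumes "K \<noteq> {}" "convex K"
  obtains x where "x \<in> K" "\<And>s. act s x = x"
proof -
  obtain m where m: "m \<in> M"
    using limits_nonempty by blast
  obtain x where x: "x \<in> K" "\<And>f. f \<in> M \<Longrightarrow> f x = x"
  proof (rule left_reversible_nonexpansive_fixed_point[OF lcs assms(1) compact assms(2), of M])
    show "f ` K \<subseteq> K" if "f \<in> M" for f
      using limits_mem[OF that] by blast
    show "\<exists>f'\<in>M. \<exists>g'\<in>M. \<forall>x\<in>K. f (f' x) = g (g' x)" if "f \<in> M" "g \<in> M" for f g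
      using limits_left_reversible[OF that] by (metis comp_apply)
  qed (use limits_nonexpansive limits_comp in auto)
  have "act s x = x" for s
    using x(2)[OF m] x(2)[OF act_limits[OF m, of s]] by simp
  then show ?thesis
    using that x(1) by blast
qed

end

theorem theorem3p3:
  fixes Q :: "('x::{real_vector, t2_space} \<Rightarrow> real) set"
    and K :: "'x set"
    and act :: "'s::semitopological_semigroup \<Rightarrow> 'x \<Rightarrow> 'x"
  assumes "reversible TYPE('s)"
    and "locally_convex_space Q"
    and "K \<noteq> {}" and "compact K" and "convex K"
    and "action_on act K"
    and "super_asymptotically_separately_nonexpansive Q act K"
    and "separately_continuous_on act K"
  shows "\<exists>x\<^sub>0\<in>K. \<forall>s. act s x\<^sub>0 = x\<^sub>0"
proof -
  obtain p where p: "p \<in> K"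
    using assms(3) by blast
  \<comment> \<open>\<open>r\<close> may be discontinuous: the locale asks for continuity in the
    point only on \<open>K\<close>, where \<open>r\<close> is the identity.\<close>
  define r where "r x = (if x \<in> K then x else p)" for x
  have r: "r x \<in> K" "x \<in> K \<Longrightarrow> r x = x" for x
    using p by (auto simp: r_def)
  have act: "act s x \<in> K" "act (s * t) x = act s (act t x)" if "x \<in> K" for s t x
    using assms(6) that by (auto simp: action_on_def)
  interpret reversible_compact_action "\<lambda>s x. act s (r x)" K Q
  proof
    show "continuous_on K (\<lambda>x. act s (r x))" for s
      using assms(8) r(2) by (simp add: separately_continuous_on_def cong: continuous_on_cong)
    show "continuous_on UNIV (\<lambda>s. act s (r x))" for x
      using assms(8) r(1) by (simp add: separately_continuous_on_def)
    show "super_asymptotically_separately_nonexpansive Q (\<lambda>s x. act s (r x)) K"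
      using assms(7) r(2) by (simp add: super_asymptotically_separately_nonexpansive_def)
  qed (use assms(1,2,4) act r in auto)
  obtain x where "x \<in> K" "\<And>s. act s (r x) = x"
    using common_fixed_point[OF assms(3,5)] by blast
  then show ?thesis
    using r(2) by metis
qed

end
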